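(* Let $p,q,r\in\mathbb{Z}$ with $\min\{p+q,\,p-q\}\geq 0$. Then \[ \frac{1}{\pi}=\frac{(\frac{1}{2})_{p+q-r}(\frac{1}{2})_{p-q-r}}{(\frac{1}{2})_{r}} \sum_{k=0}^{\infty}\frac{(\frac{1}{2})_{k+2p}(\frac{1}{2})_{k+2q}(\frac{1}{2})_{k-2q}(\frac{1}{2})_{k+r}} {k!\,(k+p+q)!\,(k+p-q)!\,(\frac{1}{2})_{k+2p-2r}}\cdot\frac{6k+4p+1}{4^{k+r+1}}. \]
   Context: For a complex number $x$ and an integer $n$ (possibly negative), the shifted factorial is defined by $(x)_n=\Gamma(x+n)/\Gamma(x)$, where $\Gamma$ is the Gamma function. *)

theory Defs
  imports "HOL-Analysis.Analysis"
begin

(* In contrast to the library's pochhammer, n may be negative.  Gamma takes the dummy value 0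
   at its poles 0, -1, -2, ...; the definition is meaningful only away from them. *)
definition shifted_factorial :: "complex \<Rightarrow> int \<Rightarrow> complex" where
  "shifted_factorial x n = Gamma (x + of_int n) / Gamma x"

end

(* With a = 1/4 + p, b = 1/4 + q, n = -1/2 - r, the series is a constant multiple of the
   nonterminating form of a 5F4(1/4) summation of Gessel and Stanton, whose sum we call S(n).  A WZ pair
   relates S(n + 1) to S(n) by a rational factor.  As m tends to infinity, S(n + m) tends to a limit
   that does not depend on n (Tannery), and S(0) = 2a since the series then stops after its first
   term; comparing the two sequences starting at n and at 0 evaluates S(n) as a quotient of Gamma
   functions.  Duplication and reflection of Gamma reduce that quotient to 1/pi. *)
theory Submission
  imports Defs
begin

section \<open>Limits of term ratios, and nonvanishing of Pochhammer symbols\<close>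

lemma affine_ratio_tendsto:
  fixes x y c d :: complex
  assumes "d \<noteq> 0"
  shows "(\<lambda>k. (x + c * of_nat k) / (y + d * of_nat k)) \<longlonglongrightarrow> c / d"
proof (rule Lim_transform_eventually)
  show "(\<lambda>k. (x / of_nat k + c) / (y / of_nat k + d)) \<longlonglongrightarrow> c / d"
    using assms by (auto intro!: tendsto_eq_intros tendsto_divide_0[OF tendsto_const] tendsto_of_nat)
  show "\<forall>\<^sub>F k in sequentially. (x / of_nat k + c) / (y / of_nat k + d)
          = (x + c * of_nat k) / (y + d * of_nat k)"
    using eventually_gt_at_top[of 0]
  proof eventually_elim
    case (elim k)
    have "x / of_nat k + c = (x + c * of_nat k) / of_nat k"
      "y / of_nat k + d = (y + d * of_nat k) / of_nat k"
      using elim by (simp_all add: field_simps)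
    then show ?case using elim by simp
  qed
qed

lemma shift_ratio_tendsto_1:
  fixes x y :: complex
  shows "(\<lambda>k. (x + of_nat k) / (y + of_nat k)) \<longlonglongrightarrow> 1"
  using affine_ratio_tendsto[of 1 x 1 y] by simp

text \<open>The recurrence is required only eventually because the ratios used below may divide by
  zero at finitely many indices.\<close>

lemma summable_norm_ratio_tendsto:
  fixes f r :: "nat \<Rightarrow> 'a::real_normed_field"
  assumes "\<forall>\<^sub>F k in sequentially. f (Suc k) = r k * f k" "r \<longlonglongrightarrow> l" "norm l < 1"
  shows "summable (\<lambda>k. norm (f k))"
proof -
  obtain c where c: "norm l < c" "c < 1" using assms(3) dense by blast
  have "\<forall>\<^sub>F k in sequentially. norm (r k) < c"
    using tendsto_norm[OF assms(2)] c(1) by (rule order_tendstoD)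
  with assms(1) have "\<forall>\<^sub>F k in sequentially. norm (f (Suc k)) \<le> c * norm (f k)"
    by eventually_elim (simp add: norm_mult mult_right_mono)
  then obtain N where "\<And>k. k \<ge> N \<Longrightarrow> norm (f (Suc k)) \<le> c * norm (f k)"
    by (auto simp: eventually_sequentially)
  then show ?thesis using c(2) by (intro summable_ratio_test[of c N]) auto
qed

lemma not_nonpos_Ints_add_nat:
  fixes z :: complex
  assumes "z \<notin> \<int>\<^sub>\<le>\<^sub>0"
  shows "z + of_nat k \<notin> \<int>\<^sub>\<le>\<^sub>0"
proof
  assume "z + of_nat k \<in> \<int>\<^sub>\<le>\<^sub>0"
  then obtain m where "z + of_nat k = - of_nat m" by (elim nonpos_Ints_cases')
  then have "z = - of_nat (m + k)" by (simp add: eq_diff_eq[symmetric])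
  then show False using assms minus_of_nat_in_nonpos_Ints by metis
qed

lemma not_nonpos_Ints_add_nonzero:
  fixes z :: complex
  assumes "z \<notin> \<int>\<^sub>\<le>\<^sub>0"
  shows "z + of_nat k \<noteq> 0"
  using not_nonpos_Ints_add_nat[OF assms, of k] by auto

lemma pochhammer_nonzero:
  fixes z :: complex
  assumes "z \<notin> \<int>\<^sub>\<le>\<^sub>0"
  shows "pochhammer z k \<noteq> 0"
  using assms pochhammer_eq_0_imp_nonpos_Int by blast

section \<open>The Gessel-Stanton series and its convergence\<close>

definition gs_coeff :: "complex \<Rightarrow> complex \<Rightarrow> nat \<Rightarrow> complex" where
  "gs_coeff a b k = pochhammer (2*a) k * pochhammer (2*b) k * pochhammer (1 - 2*b) k /
     (fact k * pochhammer (a - b + 1) k * pochhammer (a + b + 1/2) k * 4 ^ k)"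

text \<open>Generically, 2a + 3k = 2a (1 + 2a/3)_k / (2a/3)_k, so the series is 2a times a 5F4(1/4);
  the linear form avoids the denominator (2a/3)_k. All dependence on \<open>n\<close> sits in the
  last quotient, which is what the limit in \<open>n\<close> acts on.\<close>

definition gs_term :: "complex \<Rightarrow> complex \<Rightarrow> complex \<Rightarrow> nat \<Rightarrow> complex" where
  "gs_term a b n k = (2*a + 3 * of_nat k) * gs_coeff a b k *
     (pochhammer (-n) k / pochhammer (1 + 2*a + 2*n) k)"

definition gs_sum :: "complex \<Rightarrow> complex \<Rightarrow> complex \<Rightarrow> complex" where
  "gs_sum a b n = (\<Sum>k. gs_term a b n k)"

definition gs_ratio :: "complex \<Rightarrow> complex \<Rightarrow> nat \<Rightarrow> complex" where
  "gs_ratio a b k = (2*a + of_nat k) / (1 + of_nat k) * ((2*b + of_nat k) / (a - b + 1 + of_nat k))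
     * ((1 - 2*b + of_nat k) / (a + b + 1/2 + of_nat k)) / 4"

text \<open>This is pure regrouping of factors: the inverse of a product is the product of the
  inverses even when a factor is 0, so possible zeros of the lower Pochhammer symbols do no
  harm.\<close>

lemma gs_coeff_Suc: "gs_coeff a b (Suc k) = gs_ratio a b k * gs_coeff a b k"
proof -
  have "x * x' * (y * y') * (z * z') / (f' * f * (u * u') * (v * v') * (4 * p))
      = x' / f' * (y' / u') * (z' / v') / 4 * (x * y * z / (f * u * v * p))"
    for x x' y y' z z' f f' u u' v v' p :: complex
    by (simp add: mult_ac)
  moreover have "fact (Suc k) = (1 + of_nat k) * (fact k :: complex)"
    by (simp add: algebra_simps)
  ultimately show ?thesis
    unfolding gs_coeff_def gs_ratio_def pochhammer_Suc power_Suc by (simp only:)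
qed

lemma gs_ratio_tendsto: "gs_ratio a b \<longlonglongrightarrow> 1/4"
proof -
  have "gs_ratio a b \<longlonglongrightarrow> 1 * 1 * 1 / 4"
    unfolding gs_ratio_def by (intro tendsto_intros shift_ratio_tendsto_1) auto
  then show ?thesis by simp
qed

lemma eventually_affine_nonzero:
  "\<forall>\<^sub>F k in sequentially. (2*a + 3 * of_nat k :: complex) \<noteq> 0"
proof -
  obtain N :: nat where N: "norm (2*a) < of_nat N" using reals_Archimedean2 by blast
  show ?thesis using eventually_ge_at_top[of N]
  proof eventually_elim
    case (elim k)
    show ?case
    proof
      assume "2*a + 3 * of_nat k = 0"
      then have "2*a = - (3 * of_nat k)" by (simp add: eq_neg_iff_add_eq_0)
      then have "norm (2*a) = 3 * of_nat k" by (simp add: norm_mult)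
      then show False using N elim by simp
    qed
  qed
qed

text \<open>Supplies the majorant, independent of \<open>n\<close>, for Tannery's theorem.\<close>

lemma summable_norm_gs_coeff:
  "summable (\<lambda>k. norm ((2*a + 3 * of_nat k) * gs_coeff a b k))"
proof (rule summable_norm_ratio_tendsto)
  let ?r = "\<lambda>k. (2*a + 3 + 3 * of_nat k) / (2*a + 3 * of_nat k) * gs_ratio a b k"
  show "\<forall>\<^sub>F k in sequentially. (2*a + 3 * of_nat (Suc k)) * gs_coeff a b (Suc k) =
     ?r k * ((2*a + 3 * of_nat k) * gs_coeff a b k)"
    using eventually_affine_nonzero[of a] by eventually_elim (simp add: gs_coeff_Suc add_ac)
  show "?r \<longlonglongrightarrow> 3/3 * (1/4)"
    by (intro tendsto_intros affine_ratio_tendsto gs_ratio_tendsto) auto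
qed auto

lemma summable_norm_gs_term: "summable (\<lambda>k. norm (gs_term a b n k))"
proof (rule summable_norm_ratio_tendsto)
  let ?r = "\<lambda>k. (2*a + 3 + 3 * of_nat k) / (2*a + 3 * of_nat k) *
    ((- n + of_nat k) / (1 + 2*a + 2*n + of_nat k)) * gs_ratio a b k"
  show "\<forall>\<^sub>F k in sequentially. gs_term a b n (Suc k) = ?r k * gs_term a b n k"
    using eventually_affine_nonzero[of a]
  proof eventually_elim
    case (elim k)
    then show ?case unfolding gs_term_def gs_coeff_Suc pochhammer_Suc by (simp add: ac_simps)
  qed
  show "?r \<longlonglongrightarrow> 3/3 * 1 * (1/4)"
    by (intro tendsto_intros affine_ratio_tendsto shift_ratio_tendsto_1 gs_ratio_tendsto) auto
qed auto

lemma summable_gs_term: "summable (gs_term a b n)"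
  using summable_norm_gs_term by (rule summable_norm_cancel)

section \<open>The WZ recurrence in n\<close>

text \<open>The WZ certificate, shifted by one: the summand differences of the recurrence in \<open>n\<close>
  telescope to \<open>gs_cert a b n k\<close> when summed over \<open>j \<le> k\<close>. Without the shift it would have
  the factor \<open>k - 1 - n\<close> in a denominator, which may vanish.\<close>
definition gs_cert :: "complex \<Rightarrow> complex \<Rightarrow> complex \<Rightarrow> nat \<Rightarrow> complex" where
  "gs_cert a b n k = (2*a + of_nat k) * (2*b + of_nat k) * (1 - 2*b + of_nat k) / 4 *
     gs_coeff a b k * (pochhammer (-n) k / pochhammer (3 + 2*a + 2*n) k)"

text \<open>The boundary term of the telescoping disappears: successive values have a ratio tending
  to 1/4, so they are even summable.\<close>

lemma gs_cert_tendsto_0: "gs_cert a b n \<longlonglongrightarrow> 0"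
proof -
  let ?q = "\<lambda>x k. (x + 1 + of_nat k) / (x + of_nat k) :: complex"
  let ?r = "\<lambda>k. ?q (2*a) k * ?q (2*b) k * ?q (1 - 2*b) k *
    ((- n + of_nat k) / (3 + 2*a + 2*n + of_nat k)) * gs_ratio a b k"
  have ev: "\<forall>\<^sub>F k in sequentially. x + of_nat k \<noteq> 0" for x :: complex
    \<comment> \<open>With a = 3x/2 the form 2a + 3k becomes 3(x + k).\<close>
    using eventually_affine_nonzero[of "3*x/2"]
  proof eventually_elim
    case (elim k)
    have "2 * (3*x/2) + 3 * of_nat k = 3 * (x + of_nat k)" by (simp add: algebra_simps)
    with elim show ?case by (metis mult_zero_right)
  qed
  have "summable (\<lambda>k. norm (gs_cert a b n k))"
  proof (rule summable_norm_ratio_tendsto)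
    show "\<forall>\<^sub>F k in sequentially. gs_cert a b n (Suc k) = ?r k * gs_cert a b n k"
      using ev[of "2*a"] ev[of "2*b"] ev[of "1 - 2*b"]
    proof eventually_elim
      case (elim k)
      have Suc: "x + of_nat (Suc k) = x + 1 + of_nat k" for x :: complex by simp
      show ?case unfolding gs_cert_def gs_coeff_Suc pochhammer_Suc Suc using elim by (simp add: mult_ac)
    qed
    show "?r \<longlonglongrightarrow> 1 * 1 * 1 * 1 * (1/4)"
      by (intro tendsto_intros shift_ratio_tendsto_1 gs_ratio_tendsto)
  qed auto
  then show ?thesis by (rule summable_LIMSEQ_zero[OF summable_norm_cancel])
qed

text \<open>The WZ equation between the indices k and k + 1 once all Pochhammer symbols have been
  divided out, up to sign.\<close>

lemma gs_wz_polynomial: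
  fixes a b n k :: complex
  shows "(2*a + 3*(k+1)) * ((a + b + 1/2 + n) * (a - b + 1 + n) * (n + 1) * 4
      - (2 + 2*a + 2*n + k) * (3 + 2*a + 2*n + k) * (n - k))
    = (2*a + 1 + k) * (2*b + 1 + k) * (2 - 2*b + k) * (n - k)
      + 4 * (1+k) * (a - b + 1 + k) * (a + b + 1/2 + k) * (3 + 2*a + 2*n + k)"
  by algebra

text \<open>All four quantities are polynomial multiples of one common factor, called
  \<open>w\<close> in the proof, once the coefficients of the recurrence are included; what remains
  is \<open>gs_wz_polynomial\<close>.\<close>

lemma gs_term_wz_Suc:
  assumes ab: "a - b + 1 \<notin> \<int>\<^sub>\<le>\<^sub>0" "a + b + 1/2 \<notin> \<int>\<^sub>\<le>\<^sub>0" and n: "1 + 2*a + 2*n \<notin> \<int>\<^sub>\<le>\<^sub>0"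
  shows "(a + b + 1/2 + n) * (a - b + 1 + n) * gs_term a b (n + 1) (Suc k)
     - (a + 1/2 + n) * (a + 1 + n) * gs_term a b n (Suc k)
     = gs_cert a b n (Suc k) - gs_cert a b n k"
proof -
  define P where "P = 1 + 2*a + 2*n"
  define Q where "Q = pochhammer (P + 2) k"
  define K where "K = (of_nat k :: complex)"
  define A where "A = pochhammer (-n) k"
  define D where "D = (a + b + 1/2 + n) * (a - b + 1 + n)"
  define \<rho> c where "\<rho> = gs_ratio a b k" and "c = gs_coeff a b k"
  have P0: "P + of_nat j \<noteq> 0" for j
    using not_nonpos_Ints_add_nonzero[OF n] by (simp add: P_def)
  have nz: "P \<noteq> 0" "P + 1 \<noteq> 0" "P + 1 + K \<noteq> 0" "P + 2 + K \<noteq> 0"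
    using P0[of 0] P0[of 1] P0[of "Suc k"] P0[of "Suc (Suc k)"] by (simp_all add: K_def add_ac)
  \<comment> \<open>Raising \<open>n\<close> by 1 moves the lower parameter from P to P + 2.
    Splitting (P)_{k+2} at either end expresses (P)_{k+1} through Q = (P + 2)_k.\<close>
  have "Q * (P * (P + 1)) = pochhammer P (Suc (Suc k))"
    unfolding Q_def by (simp only: pochhammer_rec) (simp add: mult_ac add_ac)
  also have "\<dots> = pochhammer P (Suc k) * (P + 1 + K)"
    by (simp add: pochhammer_Suc K_def add_ac)
  finally have PQ: "pochhammer P (Suc k) = Q * (P * (P + 1)) / (P + 1 + K)"
    using nz by (simp add: field_simps)
  have Q0: "Q \<noteq> 0"
    using pochhammer_nonzero[OF not_nonpos_Ints_add_nat[OF n, of 2]] by (simp add: Q_def P_def)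
  have K1: "1 + K \<noteq> 0" unfolding K_def by (metis of_nat_Suc of_nat_neq_0)
  have "a - b + 1 + K \<noteq> 0" "a + b + 1/2 + K \<noteq> 0"
    using not_nonpos_Ints_add_nonzero ab by (auto simp: K_def)
  \<comment> \<open>The polynomial factor of the certificate is the numerator of the term ratio, so
    the certificate at k can be written with the coefficient \<open>\<rho> * c\<close> of index k +
    1.\<close>
  then have XYZ: "(2*a + K) * (2*b + K) * (1 - 2*b + K) / 4
      = \<rho> * ((1 + K) * (a - b + 1 + K) * (a + b + 1/2 + K))"
    using K1 unfolding \<rho>_def gs_ratio_def K_def[symmetric] by simp
  have t1: "gs_term a b (n + 1) (Suc k)
      = (2*a + 3*(K + 1)) * (\<rho> * c) * (-(n + 1) * A / (Q * (P + 2 + K)))"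
  proof -
    have "pochhammer (- (n + 1)) (Suc k) = -(n + 1) * A"
      by (simp add: pochhammer_rec A_def)
    moreover have "pochhammer (1 + 2*a + 2*(n + 1)) (Suc k) = Q * (P + 2 + K)"
      by (simp add: pochhammer_Suc Q_def P_def K_def algebra_simps)
    moreover have "of_nat (Suc k) = K + 1" by (simp add: K_def)
    ultimately show ?thesis
      unfolding gs_term_def gs_coeff_Suc \<rho>_def c_def by (simp only:)
  qed
  have t2: "gs_term a b n (Suc k)
      = (2*a + 3*(K + 1)) * (\<rho> * c) * (A * (K - n) / (Q * (P * (P + 1)) / (P + 1 + K)))"
  proof -
    have "pochhammer (- n) (Suc k) = A * (K - n)" by (simp add: pochhammer_Suc A_def K_def)
    moreover have "of_nat (Suc k) = K + 1" by (simp add: K_def)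
    ultimately show ?thesis
      unfolding gs_term_def gs_coeff_Suc P_def[symmetric] PQ \<rho>_def c_def by (simp only:)
  qed
  have c0: "gs_cert a b n k = \<rho> * ((1 + K) * (a - b + 1 + K) * (a + b + 1/2 + K)) * c * (A / Q)"
  proof -
    have "3 + 2*a + 2*n = P + 2" by (simp add: P_def)
    then show ?thesis unfolding gs_cert_def XYZ[symmetric] by (simp only: K_def c_def A_def Q_def)
  qed
  have c1: "gs_cert a b n (Suc k) = (2*a + 1 + K) * (2*b + 1 + K) * (2 - 2*b + K) / 4 * (\<rho> * c)
      * (A * (K - n) / (Q * (P + 2 + K)))"
  proof -
    have "3 + 2*a + 2*n = P + 2" by (simp add: P_def)
    then show ?thesis unfolding gs_cert_def gs_coeff_Suc pochhammer_Suc
      unfolding \<open>3 + 2*a + 2*n = P + 2\<close>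
      by (simp add: K_def c_def A_def Q_def \<rho>_def add_ac)
  qed
  \<comment> \<open>This coefficient of the recurrence cancels the factor P(P + 1) of
    (P)_{k+1}.\<close>
  have N: "(a + 1/2 + n) * (a + 1 + n) = P * (P + 1) / 4"
    by (simp add: P_def field_simps)
  define w where "w = \<rho> * c * A / (Q * (P + 2 + K) * 4)"
  have w1: "gs_term a b (n + 1) (Suc k) = w * ((2*a + 3*(K + 1)) * (- (n + 1)) * 4)"
    unfolding t1 w_def by simp
  have w2: "(a + 1/2 + n) * (a + 1 + n) * gs_term a b n (Suc k)
      = w * ((2*a + 3*(K + 1)) * (K - n) * (P + 1 + K) * (P + 2 + K))"
  proof -
    have "x * y / 4 * (E * r * (A * u / (Q * (x * y) / z))) = r * A / (Q * t * 4) * (E * u * z * t)"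
      if "x \<noteq> 0" "y \<noteq> 0" "z \<noteq> 0" "t \<noteq> 0" for x y z t E r u :: complex
      using that Q0 by (simp add: field_simps)
    from this[OF nz] show ?thesis unfolding N t2 w_def .
  qed
  have w3: "gs_cert a b n k
      = w * (4 * (1 + K) * (a - b + 1 + K) * (a + b + 1/2 + K) * (P + 2 + K))"
  proof -
    have "r * (x * y * z) * c * (A / Q) = r * c * A / (Q * t * 4) * (4 * x * y * z * t)"
      if "t \<noteq> 0" for x y z t r :: complex
      using that Q0 by (simp add: field_simps)
    from this[OF nz(4)] show ?thesis unfolding c0 w_def .
  qed
  have w4: "gs_cert a b n (Suc k) = w * ((2*a + 1 + K) * (2*b + 1 + K) * (2 - 2*b + K) * (K - n))"
    unfolding c1 w_def by (simp add: mult_ac)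
  have poly: "(2*a + 3*(K + 1)) * (D * (n + 1) * 4 - (P + 1 + K) * (P + 2 + K) * (n - K))
    = (2*a + 1 + K) * (2*b + 1 + K) * (2 - 2*b + K) * (n - K)
      + 4 * (1 + K) * (a - b + 1 + K) * (a + b + 1/2 + K) * (P + 2 + K)"
    using gs_wz_polynomial[of a K b n] by (simp add: D_def P_def add_ac)
  have diff: "D * (w * (X * (- (n + 1)) * 4)) - w * (X * (K - n) * Y * Z)
      = - w * (X * (D * (n + 1) * 4 - Y * Z * (n - K)))" for X Y Z
    by (simp add: algebra_simps)
  have diff': "- w * (X * (n - K) + Y) = w * (X * (K - n)) - w * Y" for X Y
    by (simp add: algebra_simps)
  have "D * gs_term a b (n + 1) (Suc k) - (a + 1/2 + n) * (a + 1 + n) * gs_term a b n (Suc k)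
    = - w * ((2*a + 3*(K + 1)) * (D * (n + 1) * 4 - (P + 1 + K) * (P + 2 + K) * (n - K)))"
    unfolding w1 w2 by (rule diff)
  also have "\<dots> = gs_cert a b n (Suc k) - gs_cert a b n k"
    unfolding poly w3 w4 by (rule diff')
  finally show ?thesis by (simp add: D_def)
qed

lemma gs_term_wz_sum:
  assumes "a - b + 1 \<notin> \<int>\<^sub>\<le>\<^sub>0" "a + b + 1/2 \<notin> \<int>\<^sub>\<le>\<^sub>0" "1 + 2*a + 2*n \<notin> \<int>\<^sub>\<le>\<^sub>0"
  shows "(\<Sum>j\<le>k. (a + b + 1/2 + n) * (a - b + 1 + n) * gs_term a b (n + 1) j
     - (a + 1/2 + n) * (a + 1 + n) * gs_term a b n j) = gs_cert a b n k"
proof (induction k)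
  case 0
  \<comment> \<open>Both sides equal a b (1 - 2b).\<close>
  show ?case by (simp add: gs_term_def gs_coeff_def gs_cert_def) (simp add: field_simps)
next
  case (Suc k)
  then show ?case using gs_term_wz_Suc[OF assms, of k] by simp
qed

text \<open>The partial sums of the WZ differences are the values of \<open>gs_cert\<close>, which
  tend to 0, so the two series balance.\<close>

lemma gs_sum_plus1:
  assumes "a - b + 1 \<notin> \<int>\<^sub>\<le>\<^sub>0" "a + b + 1/2 \<notin> \<int>\<^sub>\<le>\<^sub>0" "1 + 2*a + 2*n \<notin> \<int>\<^sub>\<le>\<^sub>0"
  shows "(a + b + 1/2 + n) * (a - b + 1 + n) * gs_sum a b (n + 1)
     = (a + 1/2 + n) * (a + 1 + n) * gs_sum a b n"
proof -
  let ?f = "\<lambda>j. (a + b + 1/2 + n) * (a - b + 1 + n) * gs_term a b (n + 1) j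
     - (a + 1/2 + n) * (a + 1 + n) * gs_term a b n j"
  have "?f sums 0"
    unfolding sums_def_le gs_term_wz_sum[OF assms] by (rule gs_cert_tendsto_0)
  moreover have "?f sums ((a + b + 1/2 + n) * (a - b + 1 + n) * gs_sum a b (n + 1)
     - (a + 1/2 + n) * (a + 1 + n) * gs_sum a b n)"
    unfolding gs_sum_def by (intro sums_diff sums_mult summable_sums summable_gs_term)
  ultimately show ?thesis using sums_unique2 by force
qed

lemma gs_sum_plus_nat:
  assumes ab: "a - b + 1 \<notin> \<int>\<^sub>\<le>\<^sub>0" "a + b + 1/2 \<notin> \<int>\<^sub>\<le>\<^sub>0" and n: "1 + 2*a + 2*n \<notin> \<int>\<^sub>\<le>\<^sub>0"
  shows "pochhammer (a + b + 1/2 + n) m * pochhammer (a - b + 1 + n) m * gs_sum a b (n + of_nat m)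
     = pochhammer (a + 1/2 + n) m * pochhammer (a + 1 + n) m * gs_sum a b n"
proof (induction m)
  case (Suc m)
  \<comment> \<open>The condition on \<open>n\<close> survives the step, since the parameter only
    moves right, by 2m.\<close>
  have "1 + 2*a + 2*(n + of_nat m) \<notin> \<int>\<^sub>\<le>\<^sub>0"
    using not_nonpos_Ints_add_nat[OF n, of "2*m"] by (simp add: algebra_simps)
  note step = gs_sum_plus1[OF ab this]
  have "pochhammer (a + b + 1/2 + n) (Suc m) * pochhammer (a - b + 1 + n) (Suc m)
        * gs_sum a b (n + of_nat (Suc m))
    = pochhammer (a + b + 1/2 + n) m * pochhammer (a - b + 1 + n) m *
      ((a + b + 1/2 + (n + of_nat m)) * (a - b + 1 + (n + of_nat m)) * gs_sum a b (n + of_nat m + 1))"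
    by (simp add: pochhammer_Suc ac_simps)
  also have "\<dots> = (a + 1/2 + (n + of_nat m)) * (a + 1 + (n + of_nat m)) *
      (pochhammer (a + b + 1/2 + n) m * pochhammer (a - b + 1 + n) m * gs_sum a b (n + of_nat m))"
    unfolding step by (simp only: mult_ac)
  also have "\<dots> = pochhammer (a + 1/2 + n) (Suc m) * pochhammer (a + 1 + n) (Suc m) * gs_sum a b n"
    unfolding Suc.IH by (simp add: pochhammer_Suc ac_simps)
  finally show ?case .
qed simp

section \<open>The limit of S(n + m) as m grows\<close>

lemma norm_pochhammer_le:
  fixes x y :: complex
  assumes "\<And>j. norm (x + of_nat j) \<le> norm (y + of_nat j)"
  shows "norm (pochhammer x k) \<le> norm (pochhammer y k)"
  using assms by (induction k) (simp_all add: pochhammer_Suc norm_mult mult_mono)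

lemma norm_pochhammer_ratio_eventually_le_1:
  fixes a n :: complex
  shows "\<forall>\<^sub>F m in sequentially. \<forall>k.
    norm (pochhammer (-(n + of_nat m)) k / pochhammer (1 + 2*a + 2*(n + of_nat m)) k) \<le> 1"
proof -
  \<comment> \<open>For m >= N this gives |n| + m + j <= Re (1 + 2a + 2(n + m) + j) for every j, so
    the quotient is bounded factor by factor and uniformly in \<open>k\<close>.\<close>
  obtain N :: nat where N: "norm n - (1 + 2 * Re a + 2 * Re n) \<le> real N"
    using real_arch_simple by blast
  show ?thesis using eventually_ge_at_top[of N]
  proof eventually_elim
    case (elim m)
    have "norm (-(n + of_nat m) + of_nat j) \<le> norm (1 + 2*a + 2*(n + of_nat m) + of_nat j)" for j
    proof -
      have "norm (-(n + of_nat m) + of_nat j) \<le> norm n + norm (of_nat m :: complex) + norm (of_nat j :: complex)"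
        by (metis norm_triangle_le norm_minus_cancel norm_triangle_ineq add_mono order_refl)
      also have "\<dots> \<le> Re (1 + 2*a + 2*(n + of_nat m) + of_nat j)"
        using N elim by simp
      also have "\<dots> \<le> norm (1 + 2*a + 2*(n + of_nat m) + of_nat j)"
        by (rule complex_Re_le_cmod)
      finally show ?thesis .
    qed
    then have "norm (pochhammer (-(n + of_nat m)) k) \<le> norm (pochhammer (1 + 2*a + 2*(n + of_nat m)) k)" for k
      by (rule norm_pochhammer_le)
    then show ?case by (auto simp: norm_divide divide_le_eq_1)
  qed
qed

lemma pochhammer_ratio_tendsto:
  fixes a n :: complex
  shows "(\<lambda>m. pochhammer (-(n + of_nat m)) k / pochhammer (1 + 2*a + 2*(n + of_nat m)) k)
    \<longlonglongrightarrow> (- 1 / 2) ^ k"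
proof (induction k)
  case (Suc k)
  have "(\<lambda>m. ((of_nat k - n) + (- 1) * of_nat m) / ((1 + 2*a + 2*n + of_nat k) + 2 * of_nat m))
    \<longlonglongrightarrow> (- 1 / 2 :: complex)"
    by (rule affine_ratio_tendsto) simp
  from tendsto_mult[OF Suc.IH this] show ?case
    by (simp add: pochhammer_Suc algebra_simps)
qed simp

text \<open>Tannery's theorem allows the limit inside the sum, where the quotient carrying
  \<open>n\<close> becomes (-1/2)^k. The resulting series is free of \<open>n\<close>, so different
  starting points share one limit.\<close>

lemma gs_sum_tendsto:
  "(\<lambda>m. gs_sum a b (n + of_nat m)) \<longlonglongrightarrow> (\<Sum>k. (2*a + 3 * of_nat k) * gs_coeff a b k * (- 1 / 2) ^ k)"
proof -
  have "(\<lambda>m. gs_term a b (n + of_nat m) k) \<longlonglongrightarrow> (2*a + 3 * of_nat k) * gs_coeff a b k * (- 1 / 2) ^ k" for k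
    unfolding gs_term_def by (intro tendsto_intros pochhammer_ratio_tendsto)
  moreover have "\<forall>\<^sub>F (k, m) in at_top \<times>\<^sub>F sequentially. norm (gs_term a b (n + of_nat m) k)
      \<le> norm ((2*a + 3 * of_nat k) * gs_coeff a b k)"
  proof -
    have "\<forall>\<^sub>F m in sequentially. \<forall>k. norm (gs_term a b (n + of_nat m) k)
      \<le> norm ((2*a + 3 * of_nat k) * gs_coeff a b k)"
      using norm_pochhammer_ratio_eventually_le_1[of n a]
    proof eventually_elim
      case (elim m)
      show ?case
        unfolding gs_term_def norm_mult[of "_ * _" "_ / _"]
        using elim by (auto intro: mult_left_le)
    qed
    \<comment> \<open>The bound is uniform in \<open>k\<close>, so only \<open>m\<close> has to be
      large in the product filter.\<close>
    then show ?thesis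
      by (subst eventually_prod_filter)
        (intro exI[of _ "\<lambda>_. True"] exI conjI, auto)
  qed
  ultimately show ?thesis
    unfolding gs_sum_def
    using tannerys_theorem[of "\<lambda>k m. gs_term a b (n + of_nat m) k", OF _ _ summable_norm_gs_coeff sequentially_bot]
    by simp
qed

section \<open>Evaluation of S(n) by Gamma functions\<close>

lemma rGamma_series_mult:
  "rGamma_series x m * rGamma_series y m = pochhammer x (Suc m) * pochhammer y (Suc m) /
     (fact m ^ 2 * exp ((x + y) * of_real (ln (of_nat m))))"
  for x y :: complex
  by (simp add: rGamma_series_def power2_eq_square distrib_right exp_add mult_ac)

text \<open>Both pairs of parameters have the same sum, so by \<open>rGamma_series_mult\<close> the
  factorials and exponentials agree and \<open>gs_sum_plus_nat\<close> becomes an identity between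
  \<open>rGamma_series\<close> products. These contain Pochhammer symbols of length m + 1, hence the
  index \<open>Suc m\<close>. The reciprocal Gamma function is entire, so the limit meets no
  poles.\<close>

lemma gs_sum_rGamma_limit:
  assumes ab: "a - b + 1 \<notin> \<int>\<^sub>\<le>\<^sub>0" "a + b + 1/2 \<notin> \<int>\<^sub>\<le>\<^sub>0" and n: "1 + 2*a + 2*n \<notin> \<int>\<^sub>\<le>\<^sub>0"
  shows "rGamma (a + b + 1/2 + n) * rGamma (a - b + 1 + n) *
      (\<Sum>k. (2*a + 3 * of_nat k) * gs_coeff a b k * (- 1 / 2) ^ k)
    = rGamma (a + 1/2 + n) * rGamma (a + 1 + n) * gs_sum a b n"
proof (rule LIMSEQ_unique)
  show "(\<lambda>m. rGamma_series (a + b + 1/2 + n) m * rGamma_series (a - b + 1 + n) m *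
      gs_sum a b (n + of_nat (Suc m))) \<longlonglongrightarrow> rGamma (a + b + 1/2 + n) * rGamma (a - b + 1 + n) *
      (\<Sum>k. (2*a + 3 * of_nat k) * gs_coeff a b k * (- 1 / 2) ^ k)"
    by (intro tendsto_intros LIMSEQ_Suc[OF gs_sum_tendsto])
  have "rGamma_series (a + b + 1/2 + n) m * rGamma_series (a - b + 1 + n) m * gs_sum a b (n + of_nat (Suc m))
    = rGamma_series (a + 1/2 + n) m * rGamma_series (a + 1 + n) m * gs_sum a b n" for m
  proof -
    have "(a + b + 1/2 + n) + (a - b + 1 + n) = (a + 1/2 + n) + (a + 1 + n)" by simp
    then show ?thesis
      unfolding rGamma_series_mult times_divide_eq_left gs_sum_plus_nat[OF assms] by simp
  qed
  then show "(\<lambda>m. rGamma_series (a + b + 1/2 + n) m * rGamma_series (a - b + 1 + n) m *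
      gs_sum a b (n + of_nat (Suc m))) \<longlonglongrightarrow> rGamma (a + 1/2 + n) * rGamma (a + 1 + n) * gs_sum a b n"
    by (simp only:) (intro tendsto_intros)
qed

lemma gs_sum_0: "gs_sum a b 0 = 2 * a"
proof -
  have "gs_term a b 0 k = 0" if "k \<notin> {0}" for k
    using that by (simp add: gs_term_def pochhammer_0_left)
  then have "gs_sum a b 0 = sum (gs_term a b 0) {0}"
    unfolding gs_sum_def by (intro suminf_finite) auto
  then show ?thesis by (simp add: gs_term_def gs_coeff_def)
qed

text \<open>The cases n and 0 of \<open>gs_sum_rGamma_limit\<close> contain the same limit series
  \<open>L\<close>; eliminating it and inserting S(0) = 2a gives the evaluation. For natural
  \<open>n\<close> the series terminates, which is the original summation.\<close>

theorem gessel_stanton_nonterminating: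
  assumes ab: "a - b + 1 \<notin> \<int>\<^sub>\<le>\<^sub>0" "a + b + 1/2 \<notin> \<int>\<^sub>\<le>\<^sub>0" and a: "1 + 2*a \<notin> \<int>\<^sub>\<le>\<^sub>0"
    and n: "1 + 2*a + 2*n \<notin> \<int>\<^sub>\<le>\<^sub>0"
  shows "rGamma (a + b + 1/2) * rGamma (a - b + 1) * (rGamma (a + 1/2 + n) * rGamma (a + 1 + n)) * gs_sum a b n
    = 2 * a * (rGamma (a + 1/2) * rGamma (a + 1)) * (rGamma (a + b + 1/2 + n) * rGamma (a - b + 1 + n))"
proof -
  define L where "L = (\<Sum>k. (2*a + 3 * of_nat k) * gs_coeff a b k * (- 1 / 2) ^ k)"
  have L: "rGamma (a + b + 1/2) * rGamma (a - b + 1) * L = rGamma (a + 1/2) * rGamma (a + 1) * (2 * a)"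
    using gs_sum_rGamma_limit[OF ab, of 0] a by (simp add: gs_sum_0 L_def)
  have "rGamma (a + b + 1/2) * rGamma (a - b + 1) * (rGamma (a + 1/2 + n) * rGamma (a + 1 + n)) * gs_sum a b n
      = rGamma (a + b + 1/2) * rGamma (a - b + 1) * (rGamma (a + b + 1/2 + n) * rGamma (a - b + 1 + n) * L)"
    using gs_sum_rGamma_limit[OF ab n] by (simp add: L_def mult.assoc)
  also have "\<dots> = rGamma (a + b + 1/2 + n) * rGamma (a - b + 1 + n)
      * (rGamma (a + b + 1/2) * rGamma (a - b + 1) * L)"
    by (simp only: mult_ac)
  also note L
  finally show ?thesis by (simp only: mult_ac)
qed

section \<open>Gamma at half-integers and quarter-integers\<close>

lemma quarter_int_not_nonpos_Ints:
  "of_int m / 4 \<notin> (\<int>\<^sub>\<le>\<^sub>0 :: complex set)" if "\<not> 4 dvd m"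
  using fraction_not_in_Ints[of 4 m, where 'a = complex] that nonpos_Ints_Int by fastforce

lemma half_plus_int_not_nonpos_Ints: "1/2 + of_int j \<notin> (\<int>\<^sub>\<le>\<^sub>0 :: complex set)"
proof -
  have "\<not> 4 dvd 2 + 4 * j" by presburger
  from quarter_int_not_nonpos_Ints[OF this] show ?thesis by (simp add: add_divide_distrib)
qed

lemma quarter_plus_int_not_nonpos_Ints:
  "1/4 + of_int j \<notin> (\<int>\<^sub>\<le>\<^sub>0 :: complex set)" "3/4 + of_int j \<notin> (\<int>\<^sub>\<le>\<^sub>0 :: complex set)"
proof -
  have "\<not> 4 dvd 1 + 4 * j" "\<not> 4 dvd 3 + 4 * j" by presburger+
  from this[THEN quarter_int_not_nonpos_Ints]
  show "1/4 + of_int j \<notin> (\<int>\<^sub>\<le>\<^sub>0 :: complex set)" "3/4 + of_int j \<notin> (\<int>\<^sub>\<le>\<^sub>0 :: complex set)"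
    by (simp_all add: add_divide_distrib)
qed

text \<open>Half-integers avoid the poles of Gamma, so the split is valid for negative
  \<open>j\<close> too and isolates the dependence on \<open>k\<close>.\<close>

lemma shifted_factorial_half_add:
  "shifted_factorial (1/2) (int k + j) = pochhammer (1/2 + of_int j) k * shifted_factorial (1/2) j"
  using half_plus_int_not_nonpos_Ints[of j]
  by (simp add: shifted_factorial_def pochhammer_Gamma Gamma_eq_zero_iff add_ac)

lemma fact_nat_add:
  assumes "j \<ge> 0"
  shows "(fact (nat (int k + j)) :: complex) = pochhammer (1 + of_int j) k * fact (nat j)"
proof -
  have "nat (int k + j) = nat j + k" using assms by simp
  moreover have "(of_int j :: complex) = of_nat (nat j)" using assms by simp
  ultimately show ?thesis by (simp add: pochhammer_fact pochhammer_product' mult.commute)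
qed

text \<open>The source of pi. The shift \<open>2*q\<close> is even, so the sine in the reflection
  formula is 1 and not -1.\<close>

lemma Gamma_half_reflection:
  "Gamma (1/2 + of_int (2*q)) * Gamma (1/2 - of_int (2*q)) = complex_of_real pi"
proof -
  have "complex_of_real pi * (1/2 + of_int (2*q)) = of_real (pi/2 + 2 * pi * of_int q)"
    by (simp add: algebra_simps)
  then have "sin (complex_of_real pi * (1/2 + of_int (2*q))) = of_real (sin (pi/2 + 2 * pi * of_int q))"
    by (simp only: sin_of_real)
  also have "sin (pi/2 + 2 * pi * of_int q) = 1"
    by (simp only: sin_add cos_int_2pin sin_int_2pin) simp
  finally have "sin (complex_of_real pi * (1/2 + of_int (2*q))) = 1" by simp
  moreover have "1 - (1/2 + of_int (2*q)) = (1/2 - of_int (2*q) :: complex)" by simp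
  ultimately show ?thesis using Gamma_reflection_complex[of "1/2 + of_int (2*q)"] by simp
qed

text \<open>Legendre duplication at a - r and at a: the factors sqrt pi cancel and the powers of 2
  leave 4^r.\<close>

lemma Gamma_quarter_ratio:
  fixes p r :: int
  defines "a \<equiv> 1/4 + of_int p :: complex"
  shows "Gamma (a - of_int r) * Gamma (a - of_int r + 1/2) * Gamma (2*a)
    = 4 powi r * (Gamma (2*a - 2 * of_int r) * (Gamma a * Gamma (a + 1/2)))"
proof -
  have dup: "Gamma (1/4 + of_int j) * Gamma (1/4 + of_int j + 1/2)
      = exp ((1/2 - 2 * of_int j) * of_real (ln 2)) * of_real (sqrt pi) * Gamma (2 * (1/4 + of_int j :: complex))" for j
    using Gamma_legendre_duplication[of "1/4 + of_int j"] quarter_plus_int_not_nonpos_Ints[of j]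
    by (simp add: algebra_simps)
  have "4 powi r = (exp (2 * of_real (ln 2)) powi r :: complex)"
    by (simp add: exp_double exp_of_real)
  also have "\<dots> = exp (2 * of_int r * of_real (ln 2))"
    by (simp add: exp_power_int mult_ac)
  finally have four: "exp ((1/2 - 2 * of_int (p - r)) * of_real (ln 2))
      = 4 powi r * exp ((1/2 - 2 * of_int p) * complex_of_real (ln 2))"
    by (simp add: algebra_simps flip: exp_add)
  have shift: "a - of_int r = 1/4 + of_int (p - r)"
    "2*a - 2 * of_int r = 2 * (1/4 + of_int (p - r))"
    by (simp_all add: a_def)
  show ?thesis
    unfolding shift unfolding a_def dup four by (simp only: mult_ac)
qed

section \<open>Specialisation to the series for 1/pi\<close>

theorem theorem1:
  fixes p q r :: int and t :: "nat \<Rightarrow> complex"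
  defines "t \<equiv> \<lambda>k.
      (shifted_factorial (1/2) (int k + 2*p) * shifted_factorial (1/2) (int k + 2*q) *
       shifted_factorial (1/2) (int k - 2*q) * shifted_factorial (1/2) (int k + r)) /
      (fact k * fact (nat (int k + p + q)) * fact (nat (int k + p - q)) *
       shifted_factorial (1/2) (int k + 2*p - 2*r)) *
      ((6 * of_nat k + 4 * of_int p + 1) / 4 powi (int k + r + 1))"
  assumes "min (p + q) (p - q) \<ge> 0"
  shows "summable t \<and>
    1 / complex_of_real pi =
      (shifted_factorial (1/2) (p + q - r) * shifted_factorial (1/2) (p - q - r)) /
      shifted_factorial (1/2) r * (\<Sum>k. t k)"
proof -
  define a b n :: complex where "a = 1/4 + of_int p" and "b = 1/4 + of_int q" and "n = - 1/2 - of_int r"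
  define N M where "N = (fact (nat (p + q)) :: complex)" and "M = (fact (nat (p - q)) :: complex)"
  let ?s = "shifted_factorial (1/2)"
  \<comment> \<open>The factors of the summand that do not involve \<open>k\<close>; the 2 comes
    from 6k + 4p + 1 = 2(2a + 3k).\<close>
  define C where "C = ?s (2*p) * ?s (2*q) * ?s (- 2*q) * ?s r * 2 / (N * M * ?s (2*p - 2*r) * 4 powi (r + 1))"
  have pq: "p + q \<ge> 0" "p - q \<ge> 0" using assms(2) by auto
  have t_eq: "t k = C * gs_term a b n k" for k
  proof -
    \<comment> \<open>The first two parameters are positive integers and give the shifted factorials
      of integers; all others are half-integers.\<close>
    have "a - b + 1 = 1 + of_int (p - q)" "a + b + 1/2 = 1 + of_int (p + q)" "2*a = 1/2 + of_int (2*p)"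
      "2*b = 1/2 + of_int (2*q)" "1 - 2*b = 1/2 + of_int (- 2*q)" "- n = 1/2 + of_int r"
      "1 + 2*a + 2*n = 1/2 + of_int (2*p - 2*r)"
      by (simp_all add: a_def b_def n_def)
    note params = this
    have powi: "(4 :: complex) powi (int k + r + 1) = 4 ^ k * 4 powi (r + 1)"
      by (simp add: power_int_add add.assoc)
    have lin: "6 * of_nat k + 4 * of_int p + 1 = 2 * (1/2 + of_int (2*p) + 3 * of_nat k :: complex)"
      by simp
    have shifts: "int k + 2*p - 2*r = int k + (2*p - 2*r)" "int k - 2*q = int k + - 2*q"
      "int k + p + q = int k + (p + q)" "int k + p - q = int k + (p - q)"
      by simp_all
    have "P2p * s1 * (P2q * s2) * (Pmq * s3) * (Pr * s4) / (f * (Ppq * N) * (Pmm * M) * (Pd * s5)) * (2 * l / (x * y))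
      = s1 * s2 * s3 * s4 * 2 / (N * M * s5 * y) * (l * (P2p * P2q * Pmq / (f * Pmm * Ppq * x)) * (Pr / Pd))"
      for P2p s1 P2q s2 Pmq s3 Pr s4 f Ppq Pmm Pd s5 l x y :: complex
      by (simp add: mult_ac)
    then show ?thesis
      unfolding t_def C_def gs_term_def gs_coeff_def params(5,7)
      unfolding params(1-4,6) powi lin shifts
        shifted_factorial_half_add fact_nat_add[OF pq(1)] fact_nat_add[OF pq(2)] N_def[symmetric] M_def[symmetric] .
  qed
  have "t = (\<lambda>k. C * gs_term a b n k)" using t_eq by auto
  then have sum: "summable t" "suminf t = C * gs_sum a b n"
    using summable_gs_term[of a b n] by (simp_all add: gs_sum_def summable_mult suminf_mult)
  define G1 G2 where "G1 = Gamma (1/2 + of_int (p + q - r) :: complex)"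
    and "G2 = Gamma (1/2 + of_int (p - q - r) :: complex)"
  define H where "H = Gamma (1/2 :: complex)"
  have HH: "H * H = of_real pi"
    by (simp add: H_def Gamma_one_half_complex flip: of_real_mult)
  have Gnz: "Gamma (1/2 + of_int j) \<noteq> (0 :: complex)" for j
    using half_plus_int_not_nonpos_Ints by (simp add: Gamma_eq_zero_iff)
  have nz: "G1 \<noteq> 0" "G2 \<noteq> 0" "N \<noteq> 0" "M \<noteq> 0" unfolding G1_def G2_def N_def M_def by (rule Gnz fact_nonzero)+
  define Z where "Z = Gamma (a - of_int r) * Gamma (a - of_int r + 1/2)"
  define W where "W = Gamma a * Gamma (a + 1/2)"
  have ZW: "Z \<noteq> 0" "W \<noteq> 0"
    using quarter_plus_int_not_nonpos_Ints[of p] quarter_plus_int_not_nonpos_Ints[of "p - r"]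
    by (simp_all add: Z_def W_def a_def Gamma_eq_zero_iff algebra_simps)
  have S: "gs_sum a b n * (G1 * G2 * W) = 2 * Z * (N * M)"
  proof -
    have fN: "rGamma (a + b + 1/2) = 1 / N" "rGamma (a - b + 1) = 1 / M"
    proof -
      have "a + b + 1/2 = 1 + of_nat (nat (p + q))" "a - b + 1 = 1 + of_nat (nat (p - q))"
        using pq by (simp_all add: a_def b_def)
      then show "rGamma (a + b + 1/2) = 1 / N" "rGamma (a - b + 1) = 1 / M"
        by (simp_all only: rGamma_inverse_Gamma Gamma_fact N_def M_def inverse_eq_divide)
    qed
    have rG: "rGamma (a + b + 1/2 + n) = 1 / G1" "rGamma (a - b + 1 + n) = 1 / G2"
      by (simp_all add: rGamma_inverse_Gamma G1_def G2_def a_def b_def n_def inverse_eq_divide algebra_simps)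
    have "a + 1/2 + n = a - of_int r" "a + 1 + n = a - of_int r + 1/2" by (simp_all add: n_def)
    then have rZ: "rGamma (a + 1/2 + n) * rGamma (a + 1 + n) = 1 / Z"
      by (simp only: rGamma_inverse_Gamma Z_def inverse_mult_distrib flip: inverse_eq_divide)
    \<comment> \<open>The prefactor 2a is absorbed by a / Gamma(a + 1) = 1 / Gamma(a).\<close>
    have "2 * a * (rGamma (a + 1/2) * rGamma (a + 1)) = 2 * rGamma (a + 1/2) * (a * rGamma (a + 1))"
      by simp
    also have "\<dots> = 2 / W"
      unfolding rGamma_plus1 by (simp add: rGamma_inverse_Gamma W_def field_simps)
    finally have rW: "2 * a * (rGamma (a + 1/2) * rGamma (a + 1)) = 2 / W" .
    have "a - b + 1 = 1 + of_nat (nat (p - q))" "a + b + 1/2 = 1 + of_nat (nat (p + q))"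
      "1 + 2*a = 1/2 + of_int (2*p + 1)" "1 + 2*a + 2*n = 1/2 + of_int (2*p - 2*r)"
      using pq by (simp_all add: a_def b_def n_def)
    then have "a - b + 1 \<notin> \<int>\<^sub>\<le>\<^sub>0" "a + b + 1/2 \<notin> \<int>\<^sub>\<le>\<^sub>0" "1 + 2*a \<notin> \<int>\<^sub>\<le>\<^sub>0" "1 + 2*a + 2*n \<notin> \<int>\<^sub>\<le>\<^sub>0"
      using half_plus_int_not_nonpos_Ints of_nat_in_nonpos_Ints_iff
      by (metis of_nat_Suc nat.distinct(1), metis of_nat_Suc nat.distinct(1), metis, metis)
    from gessel_stanton_nonterminating[OF this]
    show ?thesis unfolding fN rG rZ rW using nz ZW by (simp add: field_simps)
  qed
  have quarter: "Z * Gamma (1/2 + of_int (2*p)) = 4 powi r * (Gamma (1/2 + of_int (2*p - 2*r)) * W)"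
  proof -
    have "2*a = 1/2 + of_int (2*p)" "2*a - 2 * of_int r = 1/2 + of_int (2*p - 2*r)"
      by (simp_all add: a_def)
    then show ?thesis
      using Gamma_quarter_ratio[of p r, folded a_def] unfolding Z_def W_def by metis
  qed
  have "(?s (p + q - r) * ?s (p - q - r)) / ?s r * suminf t = 1 / complex_of_real pi"
  proof -
    define x y u v R where "x = Gamma (1/2 + of_int (2*p) :: complex)"
      and "y = Gamma (1/2 + of_int (2*p - 2*r) :: complex)"
      and "u = Gamma (1/2 + of_int (2*q) :: complex)" and "v = Gamma (1/2 + of_int (- 2*q) :: complex)"
      and "R = Gamma (1/2 + of_int r :: complex)"
    have uv: "u * v = H * H" using Gamma_half_reflection[of q] HH by (simp add: u_def v_def)
    have xy: "x \<noteq> 0" "y \<noteq> 0" "R \<noteq> 0" "H \<noteq> 0"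
      using Gnz[of 0] unfolding x_def y_def R_def H_def by (auto simp only: Gnz of_int_0 add_0_right)
    have S': "gs_sum a b n = 2 * Z * (N * M) / (G1 * G2 * W)"
      using S nz ZW by (simp add: field_simps)
    have Z': "Z = 4 powi r * (y * W) / x"
      using quarter xy by (simp add: x_def y_def field_simps)
    \<comment> \<open>The factors 2 from \<open>C\<close> and from \<open>S'\<close> cancel the 4 of
      4^(r+1), and the 4^r from duplication cancels the rest. Of the Gamma values only u v / H^4
      survives, and u v = H^2 = pi.\<close>
    have "(G1 / H) * (G2 / H) / (R / H) *
        (x / H * (u / H) * (v / H) * (R / H) * 2 / (N * M * (y / H) * (4 powi r * 4)) * gs_sum a b n)
      = (u * v) / (H * H * (H * H))"
      unfolding S' Z' using nz ZW xy by (simp add: field_simps)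
    also have "\<dots> = 1 / (H * H)" unfolding uv using xy by simp
    also have "\<dots> = 1 / complex_of_real pi" unfolding HH ..
    finally show ?thesis
      unfolding sum(2) C_def shifted_factorial_def G1_def G2_def x_def y_def u_def v_def R_def H_def
      by (simp add: power_int_add)
  qed
  then show ?thesis using sum(1) by simp
qed

end
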